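(* Let $\Delta$ be a finite thick spherical building of type $(W,S)$ with parameters $(q_s)_{s\in S}$. Let $\theta$ be a uniclass automorphism with companion automorphism $\sigma$ and suppose that $\sigma$ has order $1$ or $2$. Then $\mathbf{C}=\mathrm{disp}(\theta)$ is a full $\sigma$-conjugacy class, and for $w\in\mathbf{C}$ we have $$|\Delta_w(\theta)|=\frac{W(q)}{\mathbf{C}(q^{1/2})}\,q_w^{1/2}.$$
   Context: $\mathrm{Ch}(\Delta)$ is the chamber set and $\delta$ the Weyl distance. The companion automorphism $\sigma$ of an automorphism $\theta$ is the automorphism of the Coxeter graph with $\delta(C,D)=s\iff\delta(C^\theta,D^\theta)=s^\sigma$. $\mathrm{disp}(\theta)=\{\delta(C,C^\theta)\mid C\in\mathrm{Ch}(\Delta)\}$; $\theta$ is uniclass if $\mathrm{disp}(\theta)$ is contained in a single $\sigma$-conjugacy class $\{v^{-1}wv^\sigma\mid v\in W\}$. $\Delta_w(\theta)=\{C\in\mathrm{Ch}(\Delta)\mid\delta(C,C^\theta)=w\}$. For $s\in S$, $q_s=|\{D\in\mathrm{Ch}(\Delta)\mid\delta(C,D)=s\}|$ (independent of $C$), and $q_w=q_{s_1}\cdots q_{s_n}$ for any reduced expression $w=s_1\cdots s_n$. For $U\subseteq W$, $U(q)=\sum_{w\in U}q_w$ and $U(q^{1/2})=\sum_{w\in U}q_w^{1/2}$. *)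

theory Defs
  imports Complex_Main "HOL-Algebra.Algebra"
begin

section \<open>Coxeter systems\<close>

definition word_prod :: "('w, 'b) monoid_scheme \<Rightarrow> 'w list \<Rightarrow> 'w" where
  "word_prod W ws = foldr (\<otimes>\<^bsub>W\<^esub>) ws \<one>\<^bsub>W\<^esub>"

text \<open>
  Deletion of a factor \<open>(s t)\<^sup>m\<close>, where \<open>m = m(s,t)\<close> is the order of \<open>s t\<close> in \<open>W\<close>.
  The order function of the library returns \<open>0\<close> for elements of infinite order, in which case the
  rule deletes the empty word, i.e. gives no relation. For \<open>s = t\<close> it deletes \<open>s s\<close>.
\<close>
inductive coxeter_step :: "('w, 'b) monoid_scheme \<Rightarrow> 'w set \<Rightarrow> 'w list \<Rightarrow> 'w list \<Rightarrow> bool"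
  for W S where
  "\<lbrakk>s \<in> S; t \<in> S; us \<in> lists S; vs \<in> lists S\<rbrakk> \<Longrightarrow>
    coxeter_step W S (us @ concat (replicate (group.ord W (s \<otimes>\<^bsub>W\<^esub> t)) [s, t]) @ vs) (us @ vs)"

text \<open>
  \<open>W = \<langle>S | (s t)\<^bsup>m(s,t)\<^esup> = 1\<rangle>\<close>. Since the generators are involutions, the presented
  group is the monoid of words over \<open>S\<close> modulo the equivalence relation generated by the relators;
  \<open>presentation\<close> says that the canonical map from it to \<open>W\<close> has trivial kernel.
\<close>
locale coxeter_system = group W for W :: "('w, 'b) monoid_scheme" (structure) +
  fixes S :: "'w set"
  assumes gens_closed: "S \<subseteq> carrier W"
    and gens_generate: "generate W S = carrier W"
    and gens_involutions: "s \<in> S \<Longrightarrow> s \<noteq> \<one> \<and> s \<otimes> s = \<one>"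
    and presentation:
      "\<lbrakk>ws \<in> lists S; word_prod W ws = \<one>\<rbrakk> \<Longrightarrow> equivclp (coxeter_step W S) ws []"

definition cox_length :: "('w, 'b) monoid_scheme \<Rightarrow> 'w set \<Rightarrow> 'w \<Rightarrow> nat" where
  "cox_length W S w = (LEAST n. \<exists>ws \<in> lists S. word_prod W ws = w \<and> length ws = n)"

definition reduced_expression :: "('w, 'b) monoid_scheme \<Rightarrow> 'w set \<Rightarrow> 'w \<Rightarrow> 'w list \<Rightarrow> bool" where
  "reduced_expression W S w ws \<longleftrightarrow>
     ws \<in> lists S \<and> word_prod W ws = w \<and> length ws = cox_length W S w"

text \<open>
  The Coxeter graph has vertex set \<open>S\<close> and labels \<open>m(s,t)\<close>. Only the values of the map on \<open>S\<close>
  matter here; below it is applied to automorphisms of the group \<open>W\<close>, every Coxeter graph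
  automorphism being identified with the unique automorphism of \<open>W\<close> extending it
  (see \<open>coxeter_graph_automorphism_extends\<close>).
\<close>
definition coxeter_graph_automorphism ::
    "('w, 'b) monoid_scheme \<Rightarrow> 'w set \<Rightarrow> ('w \<Rightarrow> 'w) \<Rightarrow> bool" where
  "coxeter_graph_automorphism W S \<pi> \<longleftrightarrow> bij_betw \<pi> S S \<and>
     (\<forall>s\<in>S. \<forall>t\<in>S. group.ord W (\<pi> s \<otimes>\<^bsub>W\<^esub> \<pi> t) = group.ord W (s \<otimes>\<^bsub>W\<^esub> t))"

context coxeter_system
begin

lemma word_prod_closed: "ws \<in> lists S \<Longrightarrow> word_prod W ws \<in> carrier W"
  using gens_closed by (induction ws) (auto simp: word_prod_def)

lemma word_prod_append:
  "us \<in> lists S \<Longrightarrow> vs \<in> lists S \<Longrightarrow>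
     word_prod W (us @ vs) = word_prod W us \<otimes> word_prod W vs"
proof (induction us)
  case Nil
  then show ?case using word_prod_closed by (auto simp: word_prod_def)
next
  case (Cons a us)
  then have "a \<in> carrier W" "word_prod W us \<in> carrier W" "word_prod W vs \<in> carrier W"
    using gens_closed word_prod_closed by auto
  with Cons show ?case by (auto simp: word_prod_def m_assoc)
qed

lemma gens_inv: "s \<in> S \<Longrightarrow> inv s = s"
  using gens_closed gens_involutions by (metis inv_equality subsetD)

lemma word_prod_rev: "ws \<in> lists S \<Longrightarrow> word_prod W (rev ws) = inv (word_prod W ws)"
proof (induction ws)
  case Nil
  then show ?case by (simp add: word_prod_def)
next
  case (Cons a ws)
  then have a: "a \<in> S" "a \<in> carrier W" "ws \<in> lists S" "word_prod W ws \<in> carrier W"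
    using gens_closed word_prod_closed by auto
  have "word_prod W (rev (a # ws)) = inv (word_prod W ws) \<otimes> a"
    using Cons a by (subst rev.simps, subst word_prod_append) (auto simp: word_prod_def)
  also have "\<dots> = inv (a \<otimes> word_prod W ws)"
    using a by (simp add: inv_mult_group gens_inv)
  finally show ?case by (simp add: word_prod_def)
qed

lemma expression_exists:
  assumes "w \<in> carrier W"
  shows "\<exists>ws \<in> lists S. word_prod W ws = w"
proof -
  have "w \<in> generate W S" using assms gens_generate by simp
  then show ?thesis
  proof (induction rule: generate.induct)
    case one
    show ?case by (intro bexI[of _ "[]"]) (auto simp: word_prod_def)
  next
    case (incl h)
    then show ?case using gens_closed by (intro bexI[of _ "[h]"]) (auto simp: word_prod_def)
  next
    case (inv h)
    then show ?case using gens_closed gens_inv[of h]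
      by (intro bexI[of _ "[h]"]) (auto simp: word_prod_def)
  next
    case (eng h1 h2)
    then obtain us vs where "us \<in> lists S" "word_prod W us = h1" "vs \<in> lists S" "word_prod W vs = h2"
      by blast
    then show ?case by (intro bexI[of _ "us @ vs"]) (auto simp: word_prod_append)
  qed
qed

lemma word_prod_replicate:
  assumes "s \<in> S" "t \<in> S"
  shows "word_prod W (concat (replicate n [s, t])) = (s \<otimes> t) [^] n"
proof (induction n)
  case 0
  then show ?case by (simp add: word_prod_def)
next
  case (Suc n)
  have "set (concat (replicate n [s, t])) \<subseteq> S" using assms by auto
  then have l: "concat (replicate n [s, t]) \<in> lists S" by blast
  have "word_prod W (concat (replicate (Suc n) [s, t])) = word_prod W ([s, t] @ concat (replicate n [s,t]))"
    by simp
  also have "\<dots> = word_prod W [s, t] \<otimes> (s \<otimes> t) [^] n"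
    using assms l Suc by (subst word_prod_append) auto
  also have "\<dots> = (s \<otimes> t) [^] Suc n"
    using assms gens_closed by (subst nat_pow_Suc2) (auto simp: word_prod_def)
  finally show ?case .
qed

lemma word_prod_map_equiv:
  assumes \<pi>: "coxeter_graph_automorphism W S \<pi>"
    and e: "equivclp (coxeter_step W S) us vs"
  shows "word_prod W (map \<pi> us) = word_prod W (map \<pi> vs)"
proof -
  have \<pi>S: "\<pi> s \<in> S" if "s \<in> S" for s
    using \<pi> that by (auto simp: coxeter_graph_automorphism_def bij_betw_def)
  have step: "word_prod W (map \<pi> a) = word_prod W (map \<pi> b)" if "coxeter_step W S a b" for a b
    using that
  proof cases
    case (1 s t xs ys)
    let ?r = "concat (replicate (ord (s \<otimes> t)) [s, t])"
    have m: "map \<pi> ?r = concat (replicate (ord (s \<otimes> t)) [\<pi> s, \<pi> t])"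
      by (simp add: map_concat)
    have l: "map \<pi> xs \<in> lists S" "map \<pi> ys \<in> lists S" using 1 \<pi>S by auto
    have "set (map \<pi> ?r) \<subseteq> S" using 1 \<pi>S by auto
    then have r: "map \<pi> ?r \<in> lists S" by blast
    have "ord (\<pi> s \<otimes> \<pi> t) = ord (s \<otimes> t)"
      using \<pi> 1 by (auto simp: coxeter_graph_automorphism_def)
    then have "word_prod W (map \<pi> ?r) = (\<pi> s \<otimes> \<pi> t) [^] ord (\<pi> s \<otimes> \<pi> t)"
      unfolding m using 1 \<pi>S by (simp add: word_prod_replicate)
    also have "\<dots> = \<one>" using 1 \<pi>S gens_closed by (intro pow_ord_eq_1) auto
    finally have one: "word_prod W (map \<pi> ?r) = \<one>" .
    have "word_prod W (map \<pi> xs @ map \<pi> ?r @ map \<pi> ys)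
        = word_prod W (map \<pi> xs) \<otimes> (word_prod W (map \<pi> ?r) \<otimes> word_prod W (map \<pi> ys))"
      using l r by (metis word_prod_append append_in_lists_conv)
    also have "\<dots> = word_prod W (map \<pi> xs @ map \<pi> ys)"
      unfolding one using l by (simp add: word_prod_append word_prod_closed)
    finally show ?thesis using 1 by simp
  qed
  show ?thesis
    using e by (induction rule: equivclp_induct) (auto dest: step)
qed

lemma word_prod_map_cong:
  assumes \<pi>: "coxeter_graph_automorphism W S \<pi>"
    and us: "us \<in> lists S" and vs: "vs \<in> lists S" and eq: "word_prod W us = word_prod W vs"
  shows "word_prod W (map \<pi> us) = word_prod W (map \<pi> vs)"
proof -
  have \<pi>S: "\<pi> s \<in> S" if "s \<in> S" for s
    using \<pi> that by (auto simp: coxeter_graph_automorphism_def bij_betw_def)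
  have rv: "rev vs \<in> lists S" using vs by auto
  have l: "map \<pi> us \<in> lists S" "map \<pi> vs \<in> lists S" "rev (map \<pi> vs) \<in> lists S"
    using us vs \<pi>S by auto
  have "word_prod W (us @ rev vs) = \<one>"
    using us vs rv eq word_prod_closed by (simp add: word_prod_append word_prod_rev)
  then have "equivclp (coxeter_step W S) (us @ rev vs) []"
    using us rv by (intro presentation) auto
  from word_prod_map_equiv[OF \<pi> this]
  have "word_prod W (map \<pi> us @ rev (map \<pi> vs)) = \<one>"
    by (simp add: rev_map word_prod_def)
  then have "word_prod W (map \<pi> us) \<otimes> inv (word_prod W (map \<pi> vs)) = \<one>"
    using l by (simp add: word_prod_append word_prod_rev)
  then have "inv (inv (word_prod W (map \<pi> vs))) = word_prod W (map \<pi> us)"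
    using l word_prod_closed by (intro inv_equality) auto
  then show ?thesis
    using l word_prod_closed by simp
qed

theorem coxeter_graph_automorphism_extends:
  assumes \<pi>: "coxeter_graph_automorphism W S \<pi>"
  shows "\<exists>!\<sigma>. \<sigma> \<in> auto W \<and> (\<forall>s\<in>S. \<sigma> s = \<pi> s)"
proof -
  have bij: "bij_betw \<pi> S S" using \<pi> by (simp add: coxeter_graph_automorphism_def)
  have \<pi>S: "\<pi> s \<in> S" if "s \<in> S" for s using bij that by (auto simp: bij_betw_def)
  define \<rho> where "\<rho> = inv_into S \<pi>"
  have \<rho>S: "\<rho> s \<in> S" and \<pi>\<rho>: "\<pi> (\<rho> s) = s" if "s \<in> S" for s
    using bij that by (auto simp: \<rho>_def bij_betw_def f_inv_into_f intro: inv_into_into)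
  have \<rho>\<pi>: "\<rho> (\<pi> s) = s" if "s \<in> S" for s
    using bij that by (auto simp: \<rho>_def bij_betw_def)
  have "bij_betw \<rho> S S" unfolding \<rho>_def using bij by (rule bij_betw_inv_into)
  moreover have "ord (\<rho> s \<otimes> \<rho> t) = ord (s \<otimes> t)" if "s \<in> S" "t \<in> S" for s t
  proof -
    have "ord (\<pi> (\<rho> s) \<otimes> \<pi> (\<rho> t)) = ord (\<rho> s \<otimes> \<rho> t)"
      using \<pi> \<rho>S that unfolding coxeter_graph_automorphism_def by blast
    then show ?thesis using that \<pi>\<rho> by simp
  qed
  ultimately have \<rho>: "coxeter_graph_automorphism W S \<rho>"
    unfolding coxeter_graph_automorphism_def by blast
  define wd where "wd w = (SOME ws. ws \<in> lists S \<and> word_prod W ws = w)" for w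
  have wd: "wd w \<in> lists S \<and> word_prod W (wd w) = w" if w: "w \<in> carrier W" for w
  proof -
    obtain ws where "ws \<in> lists S \<and> word_prod W ws = w" using w by (meson expression_exists)
    then show ?thesis unfolding wd_def by (rule someI)
  qed
  define \<sigma> where "\<sigma> = (\<lambda>w\<in>carrier W. word_prod W (map \<pi> (wd w)))"
  have \<sigma>: "\<sigma> (word_prod W ws) = word_prod W (map \<pi> ws)" if "ws \<in> lists S" for ws
  proof -
    have c: "word_prod W ws \<in> carrier W" using that by (rule word_prod_closed)
    have "word_prod W (map \<pi> (wd (word_prod W ws))) = word_prod W (map \<pi> ws)"
      using wd[OF c] that by (intro word_prod_map_cong[OF \<pi>]) blast+
    then show ?thesis using c by (simp add: \<sigma>_def)
  qed
  have ml: "map \<pi> ws \<in> lists S" "map \<rho> ws \<in> lists S" if "ws \<in> lists S" for ws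
    using that \<pi>S \<rho>S by auto
  have hom: "\<sigma> \<in> hom W W"
  proof (rule homI)
    fix x assume "x \<in> carrier W"
    then show "\<sigma> x \<in> carrier W" using wd ml word_prod_closed by (simp add: \<sigma>_def)
  next
    fix x y assume "x \<in> carrier W" "y \<in> carrier W"
    then obtain us vs where uv: "us \<in> lists S" "word_prod W us = x" "vs \<in> lists S" "word_prod W vs = y"
      by (meson expression_exists)
    then have "\<sigma> (x \<otimes> y) = \<sigma> (word_prod W (us @ vs))" by (simp add: word_prod_append)
    also have "\<dots> = word_prod W (map \<pi> us @ map \<pi> vs)" using uv by (simp add: \<sigma>)
    also have "\<dots> = \<sigma> x \<otimes> \<sigma> y" using uv ml \<sigma> by (metis word_prod_append)
    finally show "\<sigma> (x \<otimes> y) = \<sigma> x \<otimes> \<sigma> y" .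
  qed
  have "inj_on \<sigma> (carrier W)"
  proof (rule inj_onI)
    fix x y assume xy: "x \<in> carrier W" "y \<in> carrier W" "\<sigma> x = \<sigma> y"
    then obtain us vs where uv: "us \<in> lists S" "word_prod W us = x" "vs \<in> lists S" "word_prod W vs = y"
      by (meson expression_exists)
    then have "word_prod W (map \<pi> us) = word_prod W (map \<pi> vs)" using xy \<sigma> by metis
    from word_prod_map_cong[OF \<rho> ml(1)[OF uv(1)] ml(1)[OF uv(3)] this]
    have "word_prod W (map (\<rho> \<circ> \<pi>) us) = word_prod W (map (\<rho> \<circ> \<pi>) vs)" by simp
    moreover have "map (\<rho> \<circ> \<pi>) us = us" "map (\<rho> \<circ> \<pi>) vs = vs"
      using uv \<rho>\<pi> by (auto intro!: map_idI)
    ultimately show "x = y" using uv by simp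
  qed
  moreover have "\<sigma> ` carrier W = carrier W"
  proof (intro equalityI subsetI)
    fix x assume "x \<in> \<sigma> ` carrier W"
    then show "x \<in> carrier W" using hom by (auto simp: hom_def)
  next
    fix x assume "x \<in> carrier W"
    then obtain us where us: "us \<in> lists S" "word_prod W us = x" by (meson expression_exists)
    have "map (\<pi> \<circ> \<rho>) us = us" using us \<pi>\<rho> by (auto intro!: map_idI)
    then have "\<sigma> (word_prod W (map \<rho> us)) = x"
      unfolding \<sigma>[OF ml(2)[OF us(1)]] map_map using us(2) by simp
    moreover have "word_prod W (map \<rho> us) \<in> carrier W"
      by (rule word_prod_closed[OF ml(2)[OF us(1)]])
    ultimately show "x \<in> \<sigma> ` carrier W" by (metis image_eqI)
  qed
  ultimately have au: "\<sigma> \<in> auto W"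
    using hom by (auto simp: auto_def Bij_def bij_betw_def \<sigma>_def)
  have ext: "\<sigma> s = \<pi> s" if "s \<in> S" for s
    using \<sigma>[of "[s]"] that \<pi>S[OF that] gens_closed by (auto simp: word_prod_def subset_eq)
  show ?thesis
  proof (rule ex1I[of _ \<sigma>])
    show "\<sigma> \<in> auto W \<and> (\<forall>s\<in>S. \<sigma> s = \<pi> s)" using au ext by blast
  next
    fix \<tau> assume \<tau>: "\<tau> \<in> auto W \<and> (\<forall>s\<in>S. \<tau> s = \<pi> s)"
    then have \<tau>h: "\<tau> \<in> hom W W" by (simp add: auto_def)
    have \<tau>w: "\<tau> (word_prod W ws) = word_prod W (map \<pi> ws)" if "ws \<in> lists S" for ws
      using that
    proof (induction ws)
      case Nil
      then show ?case using hom_one[OF \<tau>h] group_axioms by (simp add: word_prod_def)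
    next
      case (Cons a ws)
      then have "a \<in> S" "a \<in> carrier W" "word_prod W ws \<in> carrier W"
        using gens_closed word_prod_closed by auto
      with Cons \<tau> \<tau>h show ?case by (simp add: word_prod_def hom_mult)
    qed
    show "\<tau> = \<sigma>"
    proof (rule extensionalityI)
      show "\<tau> \<in> extensional (carrier W)" "\<sigma> \<in> extensional (carrier W)"
        using \<tau> au by (auto simp: auto_def Bij_def)
      fix x assume "x \<in> carrier W"
      then obtain ws where ws: "ws \<in> lists S" "word_prod W ws = x"
        by (meson expression_exists)
      show "\<tau> x = \<sigma> x" using \<sigma>[OF ws(1)] \<tau>w[OF ws(1)] ws(2) by simp
    qed
  qed
qed

end

section \<open>Buildings as W-metric spaces\<close>

locale building = coxeter_system W S for W :: "('w, 'b) monoid_scheme" (structure) and S +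
  fixes Ch :: "'c set" and \<delta> :: "'c \<Rightarrow> 'c \<Rightarrow> 'w"
  assumes Ch_nonempty: "Ch \<noteq> {}"
    and delta_closed: "\<lbrakk>C \<in> Ch; D \<in> Ch\<rbrakk> \<Longrightarrow> \<delta> C D \<in> carrier W"
    and delta_one_iff: "\<lbrakk>C \<in> Ch; D \<in> Ch\<rbrakk> \<Longrightarrow> \<delta> C D = \<one> \<longleftrightarrow> C = D"
    and delta_step: "\<lbrakk>C \<in> Ch; C' \<in> Ch; D \<in> Ch; s \<in> S; \<delta> C' C = s\<rbrakk> \<Longrightarrow>
      \<delta> C' D = s \<otimes> \<delta> C D \<or> \<delta> C' D = \<delta> C D"
    and delta_step_up: "\<lbrakk>C \<in> Ch; C' \<in> Ch; D \<in> Ch; s \<in> S; \<delta> C' C = s;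
      cox_length W S (s \<otimes> \<delta> C D) = cox_length W S (\<delta> C D) + 1\<rbrakk> \<Longrightarrow> \<delta> C' D = s \<otimes> \<delta> C D"
    and delta_extend: "\<lbrakk>C \<in> Ch; D \<in> Ch; s \<in> S\<rbrakk> \<Longrightarrow>
      \<exists>C'\<in>Ch. \<delta> C' C = s \<and> \<delta> C' D = s \<otimes> \<delta> C D"

text \<open>The \<open>s\<close>-panel of \<open>C\<close> consists of \<open>C\<close> and of the chambers counted here.\<close>
definition thick :: "'w set \<Rightarrow> 'c set \<Rightarrow> ('c \<Rightarrow> 'c \<Rightarrow> 'w) \<Rightarrow> bool" where
  "thick S Ch \<delta> \<longleftrightarrow>
     (\<forall>C\<in>Ch. \<forall>s\<in>S. infinite {D \<in> Ch. \<delta> C D = s} \<or> card {D \<in> Ch. \<delta> C D = s} \<ge> 2)"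

definition has_parameters ::
    "'w set \<Rightarrow> 'c set \<Rightarrow> ('c \<Rightarrow> 'c \<Rightarrow> 'w) \<Rightarrow> ('w \<Rightarrow> nat) \<Rightarrow> bool" where
  "has_parameters S Ch \<delta> q \<longleftrightarrow>
     (\<forall>C\<in>Ch. \<forall>s\<in>S. finite {D \<in> Ch. \<delta> C D = s} \<and> card {D \<in> Ch. \<delta> C D = s} = q s)"

text \<open>
  \<open>q\<^sub>w\<close> is independent of the reduced expression of \<open>w\<close>, so any one may be chosen.
\<close>
definition qw :: "('w, 'b) monoid_scheme \<Rightarrow> 'w set \<Rightarrow> ('w \<Rightarrow> nat) \<Rightarrow> 'w \<Rightarrow> nat" where
  "qw W S q w = prod_list (map q (SOME ws. reduced_expression W S w ws))"

definition q_series ::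
    "('w, 'b) monoid_scheme \<Rightarrow> 'w set \<Rightarrow> ('w \<Rightarrow> nat) \<Rightarrow> 'w set \<Rightarrow> real" where
  "q_series W S q U = (\<Sum>w\<in>U. real (qw W S q w))"

definition sqrt_q_series ::
    "('w, 'b) monoid_scheme \<Rightarrow> 'w set \<Rightarrow> ('w \<Rightarrow> nat) \<Rightarrow> 'w set \<Rightarrow> real" where
  "sqrt_q_series W S q U = (\<Sum>w\<in>U. sqrt (real (qw W S q w)))"

section \<open>Automorphisms\<close>

definition companion ::
    "('w, 'b) monoid_scheme \<Rightarrow> 'w set \<Rightarrow> 'c set \<Rightarrow> ('c \<Rightarrow> 'c \<Rightarrow> 'w) \<Rightarrow> ('c \<Rightarrow> 'c) \<Rightarrow> ('w \<Rightarrow> 'w) \<Rightarrow> bool"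
  where
  "companion W S Ch \<delta> \<theta> \<sigma> \<longleftrightarrow> coxeter_graph_automorphism W S \<sigma> \<and>
     (\<forall>C\<in>Ch. \<forall>D\<in>Ch. \<forall>s\<in>S. \<delta> C D = s \<longleftrightarrow> \<delta> (\<theta> C) (\<theta> D) = \<sigma> s)"

text \<open>Building automorphisms need not be type preserving.\<close>
definition building_automorphism ::
    "('w, 'b) monoid_scheme \<Rightarrow> 'w set \<Rightarrow> 'c set \<Rightarrow> ('c \<Rightarrow> 'c \<Rightarrow> 'w) \<Rightarrow> ('c \<Rightarrow> 'c) \<Rightarrow> bool" where
  "building_automorphism W S Ch \<delta> \<theta> \<longleftrightarrow>
     bij_betw \<theta> Ch Ch \<and> (\<exists>\<sigma>. companion W S Ch \<delta> \<theta> \<sigma>)"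

definition disp :: "'c set \<Rightarrow> ('c \<Rightarrow> 'c \<Rightarrow> 'w) \<Rightarrow> ('c \<Rightarrow> 'c) \<Rightarrow> 'w set" where
  "disp Ch \<delta> \<theta> = {\<delta> C (\<theta> C) | C. C \<in> Ch}"

definition displaced_by :: "'c set \<Rightarrow> ('c \<Rightarrow> 'c \<Rightarrow> 'w) \<Rightarrow> ('c \<Rightarrow> 'c) \<Rightarrow> 'w \<Rightarrow> 'c set" where
  "displaced_by Ch \<delta> \<theta> w = {C \<in> Ch. \<delta> C (\<theta> C) = w}"

definition twisted_class :: "('w, 'b) monoid_scheme \<Rightarrow> ('w \<Rightarrow> 'w) \<Rightarrow> 'w \<Rightarrow> 'w set" where
  "twisted_class W \<sigma> w = {inv\<^bsub>W\<^esub> v \<otimes>\<^bsub>W\<^esub> w \<otimes>\<^bsub>W\<^esub> \<sigma> v | v. v \<in> carrier W}"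

definition uniclass ::
    "('w, 'b) monoid_scheme \<Rightarrow> 'c set \<Rightarrow> ('c \<Rightarrow> 'c \<Rightarrow> 'w) \<Rightarrow> ('c \<Rightarrow> 'c) \<Rightarrow> ('w \<Rightarrow> 'w) \<Rightarrow> bool" where
  "uniclass W Ch \<delta> \<theta> \<sigma> \<longleftrightarrow> (\<exists>w\<in>carrier W. disp Ch \<delta> \<theta> \<subseteq> twisted_class W \<sigma> w)"

end

theory Submission
  imports Defs
begin

text \<open>
  Elements of a single \<open>\<sigma>\<close>-class have lengths of the same parity. Hence, if \<open>C\<close> is displaced by \<open>w\<close>
  and \<open>D\<close> is \<open>s\<close>-adjacent to \<open>C\<close> with \<open>\<delta>(D, C\<^sup>\<theta>) = s w\<close>, then \<open>D\<close> is displaced by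
  \<open>s w s\<^sup>\<sigma>\<close>. So the displacements are closed under twisted conjugation, and thickness leaves only
  the cases \<open>s w s\<^sup>\<sigma> = w\<close> and \<open>l(s w s\<^sup>\<sigma>) = l(w) \<plusminus> 2\<close>. When the length increases, every chamber
  displaced by \<open>s w s\<^sup>\<sigma>\<close> is \<open>s\<close>-adjacent to exactly one chamber displaced by \<open>w\<close>, so the number of
  chambers is multiplied by \<open>q\<^sub>s\<close>, while \<open>q\<^sub>w\<close> is multiplied by \<open>q\<^sub>s\<^sup>2\<close>. Thus
  \<open>|\<Delta>\<^sub>w(\<theta>)| / q\<^sub>w\<^sup>1\<^sup>/\<^sup>2\<close> is constant on the class, and the constant is found by summing over
  all chambers, of which there are \<open>W(q)\<close>.
\<close>

section \<open>Word length in Coxeter systems\<close>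

context coxeter_system
begin

abbreviation len :: "'w \<Rightarrow> nat" where
  "len \<equiv> cox_length W S"

lemma gen_closed: "s \<in> S \<Longrightarrow> s \<in> carrier W"
  using gens_closed by auto

lemma gen_sq: "s \<in> S \<Longrightarrow> s \<otimes> s = \<one>"
  using gens_involutions by auto

lemma gen_cancel_left: "s \<in> S \<Longrightarrow> w \<in> carrier W \<Longrightarrow> s \<otimes> (s \<otimes> w) = w"
  by (metis gen_closed gen_sq l_one m_assoc)

lemma gen_cancel_right: "s \<in> S \<Longrightarrow> w \<in> carrier W \<Longrightarrow> w \<otimes> s \<otimes> s = w"
  by (metis gen_closed gen_sq m_assoc r_one)

lemma word_prod_Nil: "word_prod W [] = \<one>"
  by (simp add: word_prod_def)

lemma word_prod_Cons: "word_prod W (s # ws) = s \<otimes> word_prod W ws"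
  by (simp add: word_prod_def)

section \<open>Parity of word length\<close>

lemma coxeter_step_parity:
  assumes "coxeter_step W S us vs"
  shows "even (length us) = even (length vs)"
proof -
  have *: "length (concat (replicate n [s, t])) = 2 * n" for n and s t :: 'w
    by (induction n) auto
  from assms show ?thesis
    by cases (simp add: *)
qed

text \<open>Relators have even length, so equivalent words have equal parity;
  \<open>us @ rev vs\<close> represents the identity and is thus equivalent to the empty
  word.\<close>

lemma word_prod_eq_parity:
  assumes "us \<in> lists S" "vs \<in> lists S" "word_prod W us = word_prod W vs"
  shows "even (length us) = even (length vs)"
proof -
  have rv: "rev vs \<in> lists S"
    using assms(2) by auto
  then have "word_prod W (us @ rev vs) = \<one>"
    using assms word_prod_closed by (simp add: word_prod_append word_prod_rev)
  then have "equivclp (coxeter_step W S) (us @ rev vs) []"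
    using assms(1) rv by (intro presentation) auto
  then have "even (length (us @ rev vs)) = even (length ([] :: 'w list))"
    by (induction rule: equivclp_induct) (auto dest: coxeter_step_parity)
  then show ?thesis
    by auto
qed

lemma reduced_expression_exists:
  assumes "w \<in> carrier W"
  shows "\<exists>ws. reduced_expression W S w ws"
proof -
  have "\<exists>n. \<exists>ws \<in> lists S. word_prod W ws = w \<and> length ws = n"
    using expression_exists[OF assms] by blast
  from LeastI_ex[OF this] show ?thesis
    unfolding reduced_expression_def cox_length_def by auto
qed

lemma len_word_prod_le: "ws \<in> lists S \<Longrightarrow> len (word_prod W ws) \<le> length ws"
  unfolding cox_length_def by (rule Least_le) blast

lemma len_word_prod_parity:
  assumes "ws \<in> lists S"
  shows "even (len (word_prod W ws)) = even (length ws)"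
proof -
  obtain us where "reduced_expression W S (word_prod W ws) us"
    using reduced_expression_exists word_prod_closed[OF assms] by blast
  then show ?thesis
    using word_prod_eq_parity[of us ws] assms by (auto simp: reduced_expression_def)
qed

lemma len_mult_parity:
  assumes "x \<in> carrier W" "y \<in> carrier W"
  shows "even (len (x \<otimes> y)) = (even (len x) = even (len y))"
proof -
  obtain us vs where "us \<in> lists S" "word_prod W us = x" "vs \<in> lists S" "word_prod W vs = y"
    using assms by (meson expression_exists)
  then show ?thesis
    using len_word_prod_parity[of us] len_word_prod_parity[of vs]
      len_word_prod_parity[of "us @ vs"] word_prod_append[of us vs] by auto
qed

lemma len_inv_le:
  assumes "w \<in> carrier W"
  shows "len (inv w) \<le> len w"
proof -
  obtain ws where ws: "reduced_expression W S w ws"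
    using reduced_expression_exists[OF assms] by blast
  then have "rev ws \<in> lists S" "word_prod W (rev ws) = inv w"
    by (auto simp: reduced_expression_def word_prod_rev)
  then show ?thesis
    using len_word_prod_le[of "rev ws"] ws by (simp add: reduced_expression_def)
qed

lemma len_inv: "w \<in> carrier W \<Longrightarrow> len (inv w) = len w"
  using len_inv_le[of w] len_inv_le[of "inv w"] by simp

lemma len_gen:
  assumes "s \<in> S"
  shows "odd (len s)"
  using len_word_prod_parity[of "[s]"] assms gen_closed
  by (simp add: word_prod_Cons word_prod_Nil)

section \<open>Length under multiplication by a generator, and reduced expressions\<close>

lemma len_gen_mult_le:
  assumes "s \<in> S" "w \<in> carrier W"
  shows "len (s \<otimes> w) \<le> len w + 1"
proof -
  obtain ws where ws: "reduced_expression W S w ws"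
    using reduced_expression_exists[OF assms(2)] by blast
  then have "s # ws \<in> lists S" "word_prod W (s # ws) = s \<otimes> w"
    using assms by (auto simp: reduced_expression_def word_prod_Cons)
  then show ?thesis
    using len_word_prod_le[of "s # ws"] ws by (simp add: reduced_expression_def)
qed

lemma len_gen_mult:
  assumes "s \<in> S" "w \<in> carrier W"
  shows "len (s \<otimes> w) = len w + 1 \<or> len w = len (s \<otimes> w) + 1"
proof -
  have "len (s \<otimes> w) \<le> len w + 1" "len w \<le> len (s \<otimes> w) + 1"
    using len_gen_mult_le[OF assms] len_gen_mult_le[of s "s \<otimes> w"] assms gen_closed
    by (auto simp: gen_cancel_left)
  \<comment> \<open>A generator has odd length, so multiplying by it flips the parity.\<close>
  moreover have "len (s \<otimes> w) \<noteq> len w"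
    using len_mult_parity[of s w] assms gen_closed len_gen by metis
  ultimately show ?thesis
    by linarith
qed

lemma len_mult_gen:
  assumes "s \<in> S" "w \<in> carrier W"
  shows "len (w \<otimes> s) = len w + 1 \<or> len w = len (w \<otimes> s) + 1"
proof -
  have "inv (w \<otimes> s) = s \<otimes> inv w"
    using assms gen_closed by (simp add: inv_mult_group gens_inv)
  then have "len (w \<otimes> s) = len (s \<otimes> inv w)"
    by (metis assms gen_closed len_inv m_closed)
  then show ?thesis
    using len_gen_mult[of s "inv w"] assms len_inv by simp
qed

text \<open>A shorter expression of the tail would shorten the whole word. Inductions over reduced
  words strip the first letter this way.\<close>

lemma reduced_expression_ConsD:
  assumes "reduced_expression W S w (s # ws)"
  shows "s \<in> S" "reduced_expression W S (word_prod W ws) ws" "w = s \<otimes> word_prod W ws"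
    "len w = len (word_prod W ws) + 1"
proof -
  have S: "s \<in> S" "ws \<in> lists S" and w: "w = s \<otimes> word_prod W ws" and l: "len w = Suc (length ws)"
    using assms by (auto simp: reduced_expression_def word_prod_Cons)
  then have "length ws = len (word_prod W ws)"
    using len_gen_mult_le[of s "word_prod W ws"] len_word_prod_le[of ws] word_prod_closed by force
  then show "s \<in> S" "reduced_expression W S (word_prod W ws) ws" "w = s \<otimes> word_prod W ws"
    "len w = len (word_prod W ws) + 1"
    using S w l by (auto simp: reduced_expression_def)
qed

lemma reduced_expression_Cons:
  assumes "s \<in> S" "reduced_expression W S w ws" "len (s \<otimes> w) = len w + 1"
  shows "reduced_expression W S (s \<otimes> w) (s # ws)"
  using assms by (auto simp: reduced_expression_def word_prod_Cons)

lemma reduced_expression_rev: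
  assumes "reduced_expression W S w ws"
  shows "reduced_expression W S (inv w) (rev ws)"
proof -
  have "word_prod W ws \<in> carrier W"
    using assms by (intro word_prod_closed) (simp add: reduced_expression_def)
  then show ?thesis
    using assms by (auto simp: reduced_expression_def word_prod_rev len_inv)
qed

end

section \<open>Galleries and panels\<close>

context building
begin

text \<open>Membership of \<open>E\<close> in \<open>Ch\<close> need not be demanded: the recursive
  call implies it.\<close>

fun gallery :: "'c \<Rightarrow> 'w list \<Rightarrow> 'c \<Rightarrow> bool" where
  "gallery C [] D \<longleftrightarrow> C \<in> Ch \<and> C = D"
| "gallery C (s # ws) D \<longleftrightarrow> C \<in> Ch \<and> (\<exists>E. \<delta> C E = s \<and> gallery E ws D)"

lemma gallery_in: "gallery C ws D \<Longrightarrow> C \<in> Ch \<and> D \<in> Ch"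
  by (induction ws arbitrary: C) auto

lemma gallery_snoc:
  assumes "gallery C ws D" "\<delta> D E = s" "E \<in> Ch"
  shows "gallery C (ws @ [s]) E"
  using assms by (induction ws arbitrary: C) auto

text \<open>The step axiom with target \<open>C\<close> itself gives
  \<open>\<one> = s \<otimes> \<delta> D C\<close>, because the alternative
  \<open>\<one> = \<delta> D C\<close> would force \<open>C = D\<close>.\<close>

lemma delta_gen_sym:
  assumes "C \<in> Ch" "D \<in> Ch" "s \<in> S" "\<delta> C D = s"
  shows "\<delta> D C = s"
proof -
  have "\<delta> C C = s \<otimes> \<delta> D C \<or> \<delta> C C = \<delta> D C"
    using delta_step[OF assms(2,1,1,3,4)] .
  moreover have "\<delta> C C = \<one>" "\<delta> D C \<noteq> \<one>"
    using assms delta_one_iff gens_involutions by metis+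
  ultimately have "s \<otimes> \<delta> D C = \<one>"
    by auto
  then show ?thesis
    using assms delta_closed gen_closed by (metis gen_cancel_left r_one)
qed

lemma gallery_rev:
  assumes "gallery C ws D" "ws \<in> lists S"
  shows "gallery D (rev ws) C"
  using assms
proof (induction ws arbitrary: C)
  case (Cons s ws)
  then obtain E where E: "C \<in> Ch" "\<delta> C E = s" "gallery E ws D"
    unfolding gallery.simps by blast
  have "gallery D (rev ws) E"
    using Cons.IH Cons.prems(2) E(3) by simp
  moreover have "\<delta> E C = s"
    using delta_gen_sym[of C E s] E Cons.prems(2) gallery_in[OF E(3)] by simp
  ultimately show ?case
    using gallery_snoc E(1) by simp
qed auto

text \<open>Each letter of a reduced word lengthens the tail after it, so
  \<open>delta_step_up\<close> fixes the Weyl distance at every step.\<close>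

lemma gallery_delta:
  assumes "gallery C ws D" "reduced_expression W S w ws"
  shows "\<delta> C D = w"
  using assms
proof (induction ws arbitrary: C w)
  case Nil
  then show ?case
    using delta_one_iff by (auto simp: reduced_expression_def word_prod_Nil)
next
  case (Cons s ws)
  then obtain E where E: "C \<in> Ch" "\<delta> C E = s" "gallery E ws D"
    unfolding gallery.simps by blast
  note r = reduced_expression_ConsD[OF Cons.prems(2)]
  have "\<delta> E D = word_prod W ws"
    using Cons.IH E r by blast
  then show ?case
    using delta_step_up[of E C D s] E r gallery_in[OF E(3)] by simp
qed

lemma delta_gallery:
  assumes "C \<in> Ch" "D \<in> Ch" "reduced_expression W S (\<delta> C D) ws"
  shows "gallery C ws D"
  using assms
proof (induction ws arbitrary: C)
  case Nil
  then have "\<delta> C D = \<one>"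
    by (auto simp: reduced_expression_def word_prod_Nil)
  then show ?case
    using Nil delta_one_iff by auto
next
  case (Cons s ws)
  note r = reduced_expression_ConsD[OF Cons.prems(3)]
  have "ws \<in> lists S"
    using r(2) by (simp add: reduced_expression_def)
  obtain E where E: "E \<in> Ch" "\<delta> E C = s" "\<delta> E D = s \<otimes> \<delta> C D"
    using delta_extend Cons.prems r by blast
  then have "\<delta> E D = word_prod W ws"
    using r word_prod_closed[OF \<open>ws \<in> lists S\<close>] gen_cancel_left by auto
  then have "gallery E ws D"
    using Cons E r by auto
  moreover have "\<delta> C E = s"
    using delta_gen_sym[of E C s] Cons.prems E r by blast
  ultimately show ?case
    using Cons.prems(1) by auto
qed

text \<open>Walk a reduced gallery backwards: the reversed word is reduced for the inverse.\<close>

lemma delta_sym: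
  assumes "C \<in> Ch" "D \<in> Ch"
  shows "\<delta> D C = inv (\<delta> C D)"
proof -
  obtain ws where ws: "reduced_expression W S (\<delta> C D) ws"
    using reduced_expression_exists delta_closed assms by blast
  then have "gallery D (rev ws) C"
    using gallery_rev delta_gallery assms by (auto simp: reduced_expression_def)
  then show ?thesis
    using gallery_delta reduced_expression_rev ws by blast
qed

text \<open>The axioms move the first chamber; inverses transfer them to the second.\<close>

lemma delta_step_right:
  assumes "C \<in> Ch" "D \<in> Ch" "D' \<in> Ch" "s \<in> S" "\<delta> D D' = s"
  shows "\<delta> C D' = \<delta> C D \<otimes> s \<or> \<delta> C D' = \<delta> C D"
proof -
  have "\<delta> D' C = s \<otimes> \<delta> D C \<or> \<delta> D' C = \<delta> D C"
    using delta_step[of D D' C s] delta_gen_sym assms by blast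
  moreover have "inv (s \<otimes> \<delta> D C) = \<delta> C D \<otimes> s"
    using assms delta_closed gen_closed
    by (simp add: inv_mult_group gens_inv delta_sym[of D C])
  ultimately show ?thesis
    using assms delta_sym[of D' C] delta_sym[of D C] by auto
qed

lemma delta_step_up_right:
  assumes "C \<in> Ch" "D \<in> Ch" "D' \<in> Ch" "s \<in> S" "\<delta> D D' = s"
    and "len (\<delta> C D \<otimes> s) = len (\<delta> C D) + 1"
  shows "\<delta> C D' = \<delta> C D \<otimes> s"
proof -
  have e: "inv (\<delta> C D \<otimes> s) = s \<otimes> \<delta> D C"
    using assms delta_closed gen_closed
    by (simp add: inv_mult_group gens_inv delta_sym[of C D])
  have "len (s \<otimes> \<delta> D C) = len (\<delta> D C) + 1"
    using assms delta_closed gen_closed len_inv delta_sym[of C D] e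
    by (metis m_closed)
  then have "\<delta> D' C = s \<otimes> \<delta> D C"
    using delta_step_up[of D D' C s] delta_gen_sym assms by blast
  then have "\<delta> D' C = inv (\<delta> C D \<otimes> s)"
    using e by simp
  then show ?thesis
    using assms delta_sym[of D' C] delta_closed gen_closed by simp
qed

section \<open>Panels and projections to them\<close>

lemma panel_trans:
  assumes "C \<in> Ch" "D \<in> Ch" "E \<in> Ch" "s \<in> S" "\<delta> C D = s" "\<delta> C E = s" "D \<noteq> E"
  shows "\<delta> D E = s"
proof -
  have "\<delta> D E = s \<otimes> \<delta> C E \<or> \<delta> D E = \<delta> C E"
    using delta_step[of C D E s] assms delta_gen_sym by blast
  then show ?thesis
    using assms gen_sq delta_one_iff by auto
qed

text \<open>\<open>E\<close> is the projection of \<open>D\<close> to the s-panel of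
  \<open>C\<close>. Two candidates would be s-adjacent, and stepping from one to the other would
  raise the distance back to \<open>\<delta> C D\<close>.\<close>

lemma panel_proj_unique:
  assumes "C \<in> Ch" "D \<in> Ch" "s \<in> S" "len (s \<otimes> \<delta> C D) < len (\<delta> C D)"
  shows "\<exists>!E. E \<in> Ch \<and> \<delta> C E = s \<and> \<delta> E D = s \<otimes> \<delta> C D"
proof -
  obtain E where E: "E \<in> Ch" "\<delta> E C = s" "\<delta> E D = s \<otimes> \<delta> C D"
    using delta_extend assms by blast
  then have "\<delta> C E = s"
    using delta_gen_sym assms by blast
  moreover have "E' = E" if E': "E' \<in> Ch" "\<delta> C E' = s" "\<delta> E' D = s \<otimes> \<delta> C D" for E'
  proof (rule ccontr)
    assume "E' \<noteq> E"
    then have "\<delta> E' E = s"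
      using panel_trans[of C E' E s] E E' \<open>\<delta> C E = s\<close> assms by blast
    moreover have "s \<otimes> \<delta> E D = \<delta> C D"
      using E assms delta_closed gen_cancel_left by auto
    moreover have "len (\<delta> C D) = len (s \<otimes> \<delta> C D) + 1"
      using len_gen_mult[of s "\<delta> C D"] assms delta_closed by auto
    ultimately have "\<delta> E' D = \<delta> C D"
      using delta_step_up[of E E' D s] E(1,3) E'(1) assms(2,3) by metis
    then show False
      using E'(3) assms(4) by simp
  qed
  ultimately show ?thesis
    using E by blast
qed

end

section \<open>Counting chambers in spheres\<close>

locale finite_thick_building = building W S Ch \<delta>
  for W :: "('w, 'b) monoid_scheme" (structure) and S and Ch :: "'c set" and \<delta> +
  fixes q :: "'w \<Rightarrow> nat"
  assumes finite_Ch: "finite Ch"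
    and thick: "thick S Ch \<delta>"
    and parameters: "has_parameters S Ch \<delta> q"
begin

lemma card_panel: "C \<in> Ch \<Longrightarrow> s \<in> S \<Longrightarrow> card {D \<in> Ch. \<delta> C D = s} = q s"
  using parameters by (auto simp: has_parameters_def)

lemma q_ge_2: "s \<in> S \<Longrightarrow> q s \<ge> 2"
proof -
  assume "s \<in> S"
  obtain C where "C \<in> Ch"
    using Ch_nonempty by blast
  then show ?thesis
    using thick \<open>s \<in> S\<close> finite_Ch card_panel[of C s] unfolding thick_def by fastforce
qed

lemma panel_two:
  assumes "C \<in> Ch" "s \<in> S"
  obtains D E where "D \<in> Ch" "E \<in> Ch" "D \<noteq> E" "\<delta> C D = s" "\<delta> C E = s"
proof -
  have "card {D \<in> Ch. \<delta> C D = s} \<ge> Suc (Suc 0)"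
    using q_ge_2[OF assms(2)] card_panel[OF assms] by simp
  then obtain D E where "D \<in> {D \<in> Ch. \<delta> C D = s}" "E \<in> {D \<in> Ch. \<delta> C D = s}" "D \<noteq> E"
    unfolding card_le_Suc_iff by blast
  then show ?thesis
    using that by blast
qed

text \<open>By uniqueness of projections to the s-panel of \<open>C\<close>, the sphere of type
  \<open>s \<otimes> w'\<close> is a disjoint union of \<open>q s\<close> spheres of type
  \<open>w'\<close>.\<close>

lemma card_sphere:
  assumes "C \<in> Ch" "reduced_expression W S w ws"
  shows "card {D \<in> Ch. \<delta> C D = w} = prod_list (map q ws)"
  using assms
proof (induction ws arbitrary: C w)
  case Nil
  then have "{D \<in> Ch. \<delta> C D = w} = {C}"
    using delta_one_iff by (auto simp: reduced_expression_def word_prod_Nil)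
  then show ?case
    by simp
next
  case (Cons s ws)
  note r = reduced_expression_ConsD[OF Cons.prems(2)]
  define w' where "w' = word_prod W ws"
  have w': "w' \<in> carrier W"
    using r(2) by (auto simp: reduced_expression_def w'_def intro!: word_prod_closed)
  have w: "w = s \<otimes> w'" "s \<otimes> w = w'" "len w = len w' + 1"
    using r w' gen_cancel_left by (auto simp: w'_def)
  have proj: "\<exists>!E. E \<in> Ch \<and> \<delta> C E = s \<and> \<delta> E D = w'" if "D \<in> Ch" "\<delta> C D = w" for D
    using panel_proj_unique[of C D s] that Cons.prems r w by simp
  have up: "\<delta> C D = w" if "D \<in> Ch" "E \<in> Ch" "\<delta> C E = s" "\<delta> E D = w'" for D E
    using delta_step_up[of E C D s] that Cons.prems r w by simp
  let ?P = "{E \<in> Ch. \<delta> C E = s}"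
  have "{D \<in> Ch. \<delta> C D = w} = (\<Union>E\<in>?P. {D \<in> Ch. \<delta> E D = w'})"
    using proj up by blast
  also have "card \<dots> = (\<Sum>E\<in>?P. card {D \<in> Ch. \<delta> E D = w'})"
    proof (rule card_UN_disjoint)
    show "\<forall>E\<in>?P. \<forall>E'\<in>?P. E \<noteq> E' \<longrightarrow> {D \<in> Ch. \<delta> E D = w'} \<inter> {D \<in> Ch. \<delta> E' D = w'} = {}"
      using proj up by blast
  qed (use finite_Ch in simp_all)
  also have "\<dots> = (\<Sum>E\<in>?P. prod_list (map q ws))"
    using Cons.IH r(2) by (intro sum.cong) (auto simp: w'_def)
  also have "\<dots> = q s * prod_list (map q ws)"
    using card_panel Cons.prems(1) r(1) by simp
  finally show ?case
    by simp
qed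

text \<open>All reduced expressions of \<open>w\<close> give the same product because each counts
  the same sphere; this justifies the choice in \<open>qw\<close>.\<close>

lemma qw_reduced:
  assumes "reduced_expression W S w ws"
  shows "qw W S q w = prod_list (map q ws)"
proof -
  obtain C where "C \<in> Ch"
    using Ch_nonempty by blast
  moreover have "reduced_expression W S w (SOME us. reduced_expression W S w us)"
    using assms by (rule someI)
  ultimately show ?thesis
    using card_sphere[of C w] assms unfolding qw_def by metis
qed

lemma card_sphere_qw:
  assumes "C \<in> Ch" "w \<in> carrier W"
  shows "card {D \<in> Ch. \<delta> C D = w} = qw W S q w"
  using reduced_expression_exists[OF assms(2)] card_sphere[OF assms(1)] qw_reduced by metis

lemma qw_gen_mult:
  assumes "s \<in> S" "w \<in> carrier W" "len (s \<otimes> w) = len w + 1"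
  shows "qw W S q (s \<otimes> w) = q s * qw W S q w"
proof -
  obtain ws where "reduced_expression W S w ws"
    using reduced_expression_exists assms by blast
  then show ?thesis
    using qw_reduced reduced_expression_Cons assms by fastforce
qed

lemma qw_inv:
  assumes "w \<in> carrier W"
  shows "qw W S q (inv w) = qw W S q w"
proof -
  obtain ws where "reduced_expression W S w ws"
    using reduced_expression_exists assms by blast
  then show ?thesis
    using qw_reduced reduced_expression_rev
    by (metis prod_list.rev rev_map)
qed

lemma qw_mult_gen:
  assumes "s \<in> S" "w \<in> carrier W" "len (w \<otimes> s) = len w + 1"
  shows "qw W S q (w \<otimes> s) = qw W S q w * q s"
proof -
  have e: "inv (w \<otimes> s) = s \<otimes> inv w"
    using assms gen_closed by (simp add: inv_mult_group gens_inv)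
  have "len (s \<otimes> inv w) = len (inv w) + 1"
    by (metis assms e gen_closed len_inv m_closed)
  then show ?thesis
    using qw_gen_mult[of s "inv w"] assms e qw_inv
    by (metis gen_closed inv_closed m_closed mult.commute)
qed

lemma qw_pos:
  assumes "w \<in> carrier W"
  shows "qw W S q w > 0"
proof -
  obtain ws where ws: "reduced_expression W S w ws"
    using reduced_expression_exists assms by blast
  then have "0 \<notin> q ` set ws"
    using q_ge_2 by (fastforce simp: reduced_expression_def)
  then show ?thesis
    using qw_reduced[OF ws] by (auto simp: prod_list_zero_iff intro: gr0I)
qed

lemma sphere_nonempty:
  assumes "C \<in> Ch" "w \<in> carrier W"
  obtains D where "D \<in> Ch" "\<delta> C D = w"
proof -
  have "{D \<in> Ch. \<delta> C D = w} \<noteq> {}"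
    using card_sphere_qw[OF assms] qw_pos[OF assms(2)] by (metis card.empty less_irrefl)
  then show ?thesis
    using that by blast
qed

lemma card_Ch:
  assumes "finite (carrier W)"
  shows "real (card Ch) = q_series W S q (carrier W)"
proof -
  obtain C where C: "C \<in> Ch"
    using Ch_nonempty by blast
  have "card Ch = (\<Sum>w\<in>carrier W. card {D \<in> Ch. \<delta> C D = w})"
    using sum.group[of Ch "carrier W" "\<delta> C" "\<lambda>_. 1::nat"] C delta_closed finite_Ch assms
    by (force simp: image_subset_iff)
  also have "\<dots> = (\<Sum>w\<in>carrier W. qw W S q w)"
    using C card_sphere_qw by simp
  finally show ?thesis
    by (simp add: q_series_def)
qed

text \<open>
  This holds in every Coxeter group, but thickness gives a shorter proof than the presentation:
  one of two chambers of a panel lies away from the projection to it.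
\<close>
lemma folding:
  assumes "s \<in> S" "t \<in> S" "w \<in> carrier W"
    and "len (s \<otimes> w) = len w + 1" "len (w \<otimes> t) = len w + 1" "len (s \<otimes> w \<otimes> t) = len w"
  shows "s \<otimes> w = w \<otimes> t"
proof (rule ccontr)
  assume ne: "s \<otimes> w \<noteq> w \<otimes> t"
  note cl = assms(3) gen_closed[OF assms(1)] gen_closed[OF assms(2)]
  obtain C where C: "C \<in> Ch"
    using Ch_nonempty by blast
  obtain D where D: "D \<in> Ch" "\<delta> C D = w"
    by (rule sphere_nonempty[OF C assms(3)])
  obtain C' where C': "C' \<in> Ch" "\<delta> C' C = s" "\<delta> C' D = s \<otimes> w"
    using delta_extend[OF C D(1) assms(1)] D(2) by blast
  obtain D1 D2 where D12: "D1 \<in> Ch" "D2 \<in> Ch" "D1 \<noteq> D2" "\<delta> D D1 = t" "\<delta> D D2 = t"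
    by (rule panel_two[OF D(1) assms(2)])
  \<comment> \<open>Moving the first chamber from \<open>C\<close> to \<open>C'\<close> leaves
    \<open>s w t\<close> or \<open>w t\<close>; moving the second from \<open>D\<close> to
    \<open>E\<close> leaves \<open>s w t\<close> or \<open>s w\<close>. By \<open>ne\<close> only
    \<open>s w t\<close> is common.\<close>
  have far: "\<delta> C' E = s \<otimes> w \<otimes> t" if E: "E \<in> Ch" "\<delta> D E = t" for E
  proof -
    have "\<delta> C E = w \<otimes> t"
      using delta_step_up_right[of C D E t] C D E assms by simp
    then have "\<delta> C' E = s \<otimes> w \<otimes> t \<or> \<delta> C' E = w \<otimes> t"
      using delta_step[of C C' E s] C C' E assms cl by (simp add: m_assoc)
    moreover have "\<delta> C' E = s \<otimes> w \<otimes> t \<or> \<delta> C' E = s \<otimes> w"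
      using delta_step_right[of C' D E t] C' D E assms by simp
    ultimately show ?thesis
      using ne by auto
  qed
  \<comment> \<open>Both chambers are at distance \<open>s w t\<close> from \<open>C'\<close>, yet
    \<open>t\<close> lengthens this, so the step from \<open>D1\<close> to \<open>D2\<close> has to
    change the distance.\<close>
  have "\<delta> D1 D2 = t"
    using panel_trans[of D D1 D2 t] D D12 assms by blast
  moreover have "s \<otimes> w \<otimes> t \<otimes> t = s \<otimes> w"
    using cl assms(2) gen_cancel_right by simp
  ultimately have "\<delta> C' D2 = s \<otimes> w"
    using delta_step_up_right[of C' D1 D2 t] far[of D1] C' D12 assms by simp
  then show False
    using far[of D2] D12 assms by simp
qed

end

section \<open>Uniclass automorphisms\<close>

text \<open>\<open>companion\<close> constrains \<sigma> on \<open>S\<close> only;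
  \<open>sigma_auto\<close> makes it the extension to \<open>W\<close> that twisted classes
  use.\<close>

locale uniclass_automorphism = finite_thick_building W S Ch \<delta> q
  for W :: "('w, 'b) monoid_scheme" (structure) and S and Ch :: "'c set" and \<delta> and q +
  fixes \<theta> :: "'c \<Rightarrow> 'c" and \<sigma> :: "'w \<Rightarrow> 'w"
  assumes theta_bij: "bij_betw \<theta> Ch Ch"
    and companion: "companion W S Ch \<delta> \<theta> \<sigma>"
    and sigma_auto: "\<sigma> \<in> auto W"
    and uniclass: "uniclass W Ch \<delta> \<theta> \<sigma>"
begin

lemma theta_closed: "C \<in> Ch \<Longrightarrow> \<theta> C \<in> Ch"
  using theta_bij by (auto simp: bij_betw_def)

lemma sigma_gen: "s \<in> S \<Longrightarrow> \<sigma> s \<in> S"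
  using companion by (auto simp: companion_def coxeter_graph_automorphism_def bij_betw_def)

lemma theta_adjacent:
  "C \<in> Ch \<Longrightarrow> D \<in> Ch \<Longrightarrow> s \<in> S \<Longrightarrow> \<delta> (\<theta> C) (\<theta> D) = \<sigma> s \<longleftrightarrow> \<delta> C D = s"
  using companion by (auto simp: companion_def)

lemma sigma_mult: "x \<in> carrier W \<Longrightarrow> y \<in> carrier W \<Longrightarrow> \<sigma> (x \<otimes> y) = \<sigma> x \<otimes> \<sigma> y"
  using sigma_auto by (auto simp: auto_def hom_def)

lemma sigma_closed: "x \<in> carrier W \<Longrightarrow> \<sigma> x \<in> carrier W"
  using sigma_auto by (auto simp: auto_def hom_def)

lemma sigma_one: "\<sigma> \<one> = \<one>"
  using sigma_auto hom_one[of \<sigma> W W] by (auto simp: auto_def is_group)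

lemma sigma_word_prod: "ws \<in> lists S \<Longrightarrow> \<sigma> (word_prod W ws) = word_prod W (map \<sigma> ws)"
proof (induction ws)
  case (Cons s ws)
  then show ?case
    using word_prod_closed[of ws] gen_closed[of s] by (simp add: word_prod_Cons sigma_mult)
qed (simp add: word_prod_Nil sigma_one)

lemma sigma_len_parity:
  assumes "v \<in> carrier W"
  shows "even (len (\<sigma> v)) = even (len v)"
proof -
  obtain ws where ws: "ws \<in> lists S" "word_prod W ws = v"
    using expression_exists assms by blast
  moreover have "map \<sigma> ws \<in> lists S"
    using ws sigma_gen by auto
  ultimately show ?thesis
    using sigma_word_prod len_word_prod_parity by (metis length_map)
qed

text \<open>\<theta> carries the s-panel of \<open>C\<close> bijectively onto the panel of type
  \<open>\<sigma> s\<close> of \<open>\<theta> C\<close>.\<close>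

lemma q_sigma:
  assumes "s \<in> S"
  shows "q (\<sigma> s) = q s"
proof -
  obtain C where C: "C \<in> Ch"
    using Ch_nonempty by blast
  have "{D \<in> Ch. \<delta> (\<theta> C) D = \<sigma> s} = \<theta> ` {D \<in> Ch. \<delta> C D = s}"
  proof (intro equalityI subsetI)
    fix D assume "D \<in> {D \<in> Ch. \<delta> (\<theta> C) D = \<sigma> s}"
    then obtain E where "E \<in> Ch" "D = \<theta> E" "\<delta> (\<theta> C) D = \<sigma> s"
      using theta_bij unfolding bij_betw_def by blast
    then show "D \<in> \<theta> ` {D \<in> Ch. \<delta> C D = s}"
      using theta_adjacent[OF C _ assms] by simp
  next
    fix D assume "D \<in> \<theta> ` {D \<in> Ch. \<delta> C D = s}"
    then obtain E where "E \<in> Ch" "D = \<theta> E" "\<delta> C E = s"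
      by blast
    then show "D \<in> {D \<in> Ch. \<delta> (\<theta> C) D = \<sigma> s}"
      using theta_adjacent[OF C _ assms] theta_closed by simp
  qed
  moreover have "inj_on \<theta> {D \<in> Ch. \<delta> C D = s}"
    using theta_bij unfolding bij_betw_def inj_on_def by blast
  ultimately show ?thesis
    using card_panel[of C s] card_panel[of "\<theta> C" "\<sigma> s"] C assms theta_closed sigma_gen
    by (simp add: card_image)
qed

section \<open>Displacements of adjacent chambers\<close>

abbreviation displacements :: "'w set" where
  "displacements \<equiv> disp Ch \<delta> \<theta>"

lemma disp_in: "C \<in> Ch \<Longrightarrow> \<delta> C (\<theta> C) \<in> displacements"
  by (auto simp: disp_def)

lemma disp_closed: "w \<in> displacements \<Longrightarrow> w \<in> carrier W"
  using delta_closed theta_closed by (auto simp: disp_def)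

lemma twisted_classE:
  assumes "x \<in> twisted_class W \<sigma> w"
  obtains v where "v \<in> carrier W" "x = inv v \<otimes> w \<otimes> \<sigma> v"
  using assms unfolding twisted_class_def by blast

text \<open>\<open>inv v\<close> and \<open>\<sigma> v\<close> have equal parity and cancel, so
  parity is constant on a twisted class; the uniclass hypothesis puts all displacements into
  one.\<close>

lemma disp_parity:
  assumes "x \<in> displacements" "y \<in> displacements"
  shows "even (len x) = even (len y)"
proof -
  obtain w where w: "w \<in> carrier W" "displacements \<subseteq> twisted_class W \<sigma> w"
    using uniclass by (auto simp: uniclass_def)
  have "even (len z) = even (len w)" if z: "z \<in> displacements" for z
  proof -
    obtain v where "v \<in> carrier W" "z = inv v \<otimes> w \<otimes> \<sigma> v"
      using subsetD[OF w(2) z] by (elim twisted_classE)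
    then show ?thesis
      using w(1) sigma_closed[of v]
        len_mult_parity[of "inv v \<otimes> w" "\<sigma> v"] len_mult_parity[of "inv v" w]
        sigma_len_parity[of v] len_inv[of v] by auto
  qed
  then show ?thesis
    using assms by blast
qed

text \<open>Passing from \<open>\<theta> C\<close> to \<open>\<theta> D\<close> leaves only the last
  factor in doubt, and without it the displacement would have the wrong parity.\<close>

lemma disp_panel:
  assumes "C \<in> Ch" "D \<in> Ch" "s \<in> S" "\<delta> C D = s"
    and "\<delta> D (\<theta> C) = s \<otimes> \<delta> C (\<theta> C)"
  shows "\<delta> D (\<theta> D) = s \<otimes> \<delta> C (\<theta> C) \<otimes> \<sigma> s"
proof -
  have "\<delta> (\<theta> C) (\<theta> D) = \<sigma> s"
    using theta_adjacent assms by blast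
  then have "\<delta> D (\<theta> D) = s \<otimes> \<delta> C (\<theta> C) \<otimes> \<sigma> s \<or> \<delta> D (\<theta> D) = s \<otimes> \<delta> C (\<theta> C)"
    using delta_step_right[of D "\<theta> C" "\<theta> D" "\<sigma> s"] assms theta_closed sigma_gen by simp
  moreover have "\<delta> D (\<theta> D) \<noteq> s \<otimes> \<delta> C (\<theta> C)"
    using disp_parity[of "\<delta> D (\<theta> D)" "\<delta> C (\<theta> C)"] disp_in assms len_gen[OF assms(3)]
      len_mult_parity[of s "\<delta> C (\<theta> C)"] gen_closed disp_closed by metis
  ultimately show ?thesis
    by blast
qed

lemma disp_conj_gen:
  assumes "w \<in> displacements" "s \<in> S"
  shows "s \<otimes> w \<otimes> \<sigma> s \<in> displacements"
proof -
  obtain C where C: "C \<in> Ch" "w = \<delta> C (\<theta> C)"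
    using assms by (auto simp: disp_def)
  obtain D where "D \<in> Ch" "\<delta> D C = s" "\<delta> D (\<theta> C) = s \<otimes> w"
    using delta_extend[OF C(1) theta_closed[OF C(1)] assms(2)] C by blast
  then have "\<delta> D (\<theta> D) = s \<otimes> w \<otimes> \<sigma> s"
    using disp_panel[of C D s] C assms delta_gen_sym by blast
  then show ?thesis
    using disp_in \<open>D \<in> Ch\<close> by metis
qed

text \<open>Here every s-neighbour \<open>A\<close> of \<open>C\<close> would have
  \<open>\<theta> A\<close> at the shorter distance \<open>w t\<close> from \<open>C\<close>, with
  \<open>t = \<sigma> s\<close>. The panel of \<open>\<theta> C\<close> contains only one such
  chamber, but thickness supplies two neighbours.\<close>

lemma not_mixed:
  assumes "w \<in> displacements" "s \<in> S"
    and "len (s \<otimes> w) = len w + 1" "len w = len (w \<otimes> \<sigma> s) + 1" "len (s \<otimes> w \<otimes> \<sigma> s) = len w"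
  shows False
proof -
  let ?t = "\<sigma> s"
  have t: "?t \<in> S"
    using assms sigma_gen by blast
  obtain C where C: "C \<in> Ch" "\<delta> C (\<theta> C) = w"
    using assms by (auto simp: disp_def)
  have w: "w \<in> carrier W"
    using assms disp_closed by blast
  note cl = w gen_closed[OF assms(2)] gen_closed[OF t]
  \<comment> \<open>Equality would give \<open>s w = w t\<close>, whose lengths differ by
    two.\<close>
  have ne: "s \<otimes> w \<otimes> ?t \<noteq> w"
    using gen_cancel_right[OF t, of "s \<otimes> w"] cl assms(3,4) by auto
  obtain D E where DE: "D \<in> Ch" "E \<in> Ch" "D \<noteq> E" "\<delta> C D = s" "\<delta> C E = s"
    by (rule panel_two[OF C(1) assms(2)])
  \<comment> \<open>Compared with \<open>\<delta> A (\<theta> A)\<close> the value is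
    \<open>w t\<close> or \<open>s w t\<close>, compared with \<open>\<delta> C (\<theta> C)\<close>
    it is \<open>w t\<close> or \<open>w\<close>; \<open>ne\<close> leaves
    \<open>w t\<close>.\<close>
  have near: "\<delta> C (\<theta> A) = w \<otimes> ?t" if A: "A \<in> Ch" "\<delta> C A = s" for A
  proof -
    have "\<delta> A (\<theta> C) = s \<otimes> w"
      using delta_step_up[of C A "\<theta> C" s] C A assms(2,3) delta_gen_sym[of C A s] theta_closed[of C]
      by simp
    then have "\<delta> A (\<theta> A) = s \<otimes> w \<otimes> ?t"
      using disp_panel[of C A s] C A assms(2) by simp
    moreover have "s \<otimes> (s \<otimes> w \<otimes> ?t) = w \<otimes> ?t"
      using cl assms(2) gen_cancel_left by (simp add: m_assoc)
    ultimately have "\<delta> C (\<theta> A) = w \<otimes> ?t \<or> \<delta> C (\<theta> A) = s \<otimes> w \<otimes> ?t"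
      using delta_step[of A C "\<theta> A" s] C A assms theta_closed by simp
    moreover have "\<delta> C (\<theta> A) = w \<otimes> ?t \<or> \<delta> C (\<theta> A) = w"
      using delta_step_right[of C "\<theta> C" "\<theta> A" ?t] C A t theta_closed theta_adjacent assms by simp
    ultimately show ?thesis
      using ne by auto
  qed
  have "\<delta> D E = s"
    using panel_trans[of C D E s] C DE assms by blast
  then have "\<delta> (\<theta> D) (\<theta> E) = ?t"
    using theta_adjacent DE assms by blast
  moreover have "w \<otimes> ?t \<otimes> ?t = w"
    using w t gen_cancel_right by simp
  ultimately have "\<delta> C (\<theta> E) = w"
    using delta_step_up_right[of C "\<theta> D" "\<theta> E" ?t] near[of D] C DE t theta_closed assms(4) by simp
  then have "len w = len (w \<otimes> ?t)"
    using near[OF DE(2,5)] by metis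
  then show False
    using assms(4) by simp
qed

lemma disp_conj_gen_cases:
  assumes "w \<in> displacements" "s \<in> S"
  obtains (fixed) "s \<otimes> w \<otimes> \<sigma> s = w"
  | (up) "len (s \<otimes> w) = len w + 1" "len (s \<otimes> w \<otimes> \<sigma> s) = len (s \<otimes> w) + 1"
  | (down) "len w = len (s \<otimes> w) + 1" "len (s \<otimes> w) = len (s \<otimes> w \<otimes> \<sigma> s) + 1"
proof -
  let ?t = "\<sigma> s" and ?v = "s \<otimes> w \<otimes> \<sigma> s"
  have t: "?t \<in> S" and w: "w \<in> carrier W"
    using assms sigma_gen disp_closed by blast+
  note cl = w gen_closed[OF assms(2)] gen_closed[OF t]
  have v: "?v \<in> displacements" "s \<otimes> ?v = w \<otimes> ?t" "?v \<otimes> ?t = s \<otimes> w" "s \<otimes> ?v \<otimes> ?t = w"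
    using disp_conj_gen[OF assms] cl assms(2) t by (simp_all add: m_assoc gen_cancel_left gen_sq)
  have l: "len (s \<otimes> w) = len w + 1 \<or> len w = len (s \<otimes> w) + 1"
    "len (w \<otimes> ?t) = len w + 1 \<or> len w = len (w \<otimes> ?t) + 1"
    "len ?v = len (s \<otimes> w) + 1 \<or> len (s \<otimes> w) = len ?v + 1"
    "len ?v = len (w \<otimes> ?t) + 1 \<or> len (w \<otimes> ?t) = len ?v + 1"
    using len_gen_mult[OF assms(2) w] len_mult_gen[OF t w] len_mult_gen[OF t, of "s \<otimes> w"]
      len_gen_mult[OF assms(2) disp_closed[OF v(1)]] v(2) cl by auto
  \<comment> \<open>The letters \<open>p\<close> and \<open>m\<close> record whether
    \<open>w\<close> gets longer or shorter, first under \<open>s\<close> on the left, then under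
    \<open>?t\<close> on the right.\<close>
  consider "len ?v \<noteq> len w" | (pp) "len ?v = len w" "len (s \<otimes> w) = len w + 1" "len (w \<otimes> ?t) = len w + 1"
    | (mm) "len ?v = len w" "len w = len (s \<otimes> w) + 1" "len w = len (w \<otimes> ?t) + 1"
    | (pm) "len ?v = len w" "len (s \<otimes> w) = len w + 1" "len w = len (w \<otimes> ?t) + 1"
    | (mp) "len ?v = len w" "len w = len (s \<otimes> w) + 1" "len (w \<otimes> ?t) = len w + 1"
    using l by blast
  then show ?thesis
  proof cases
    case 1
    then show ?thesis
      using l up down by linarith
  next
    case pp
    then have "s \<otimes> w = w \<otimes> ?t"
      using folding assms(2) t w by blast
    then show ?thesis
      using fixed w t gen_cancel_right by simp
  next
    case mm
    \<comment> \<open>Folding starts from the shorter element \<open>s w\<close>, which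
      \<open>s\<close> lengthens on the left and \<open>?t\<close> on the right.\<close>
    have "s \<otimes> (s \<otimes> w) = s \<otimes> w \<otimes> ?t"
      using folding[of s ?t "s \<otimes> w"] mm assms(2) t cl gen_cancel_left by simp
    then show ?thesis
      using fixed assms(2) w gen_cancel_left by simp
  next
    case pm
    then show ?thesis
      using not_mixed assms by blast
  next
    case mp
    \<comment> \<open>For \<open>?v\<close> in place of \<open>w\<close> the pattern is reversed:
      \<open>s\<close> lengthens and \<open>?t\<close> shortens.\<close>
    then show ?thesis
      using not_mixed[of ?v s] assms(2) v by simp
  qed
qed

text \<open>The s-neighbours of chambers displaced by \<open>w\<close> form sets of size
  \<open>q s\<close>; \<open>up'\<close> and \<open>down\<close> show that they cover exactly the
  new set, \<open>unique\<close> that they are disjoint.\<close>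

lemma card_displaced_up:
  assumes "w \<in> displacements" "s \<in> S"
    and up: "len (s \<otimes> w) = len w + 1" "len (s \<otimes> w \<otimes> \<sigma> s) = len (s \<otimes> w) + 1"
  shows "card (displaced_by Ch \<delta> \<theta> (s \<otimes> w \<otimes> \<sigma> s)) = q s * card (displaced_by Ch \<delta> \<theta> w)"
proof -
  let ?t = "\<sigma> s" and ?v = "s \<otimes> w \<otimes> \<sigma> s"
  have t: "?t \<in> S" and w: "w \<in> carrier W"
    using assms sigma_gen disp_closed by blast+
  note cl = w gen_closed[OF assms(2)] gen_closed[OF t]
  have sv: "s \<otimes> ?v \<otimes> ?t = w" "?v \<otimes> ?t = s \<otimes> w"
    using cl assms(2) t by (simp_all add: m_assoc gen_cancel_left gen_sq)
  have up': "\<delta> D (\<theta> C) = s \<otimes> w \<and> \<delta> D (\<theta> D) = ?v"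
    if "C \<in> Ch" "D \<in> Ch" "\<delta> C D = s" "\<delta> C (\<theta> C) = w" for C D
  proof -
    have "\<delta> D (\<theta> C) = s \<otimes> w"
      using delta_step_up[of C D "\<theta> C" s] that assms(2,3) delta_gen_sym[of C D s] theta_closed[of C]
      by simp
    then show ?thesis
      using disp_panel[of C D s] that assms(2) by simp
  qed
  have down: "\<exists>C\<in>Ch. \<delta> C D = s \<and> \<delta> C (\<theta> C) = w" if D: "D \<in> Ch" "\<delta> D (\<theta> D) = ?v" for D
  proof -
    obtain C where "C \<in> Ch" "\<delta> C D = s" "\<delta> C (\<theta> D) = s \<otimes> ?v"
      using delta_extend[OF D(1) theta_closed[OF D(1)] assms(2)] D by auto
    then show ?thesis
      using disp_panel[of D C s] D sv assms(2) delta_gen_sym by metis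
  qed
  \<comment> \<open>Otherwise \<open>E\<close> would be an s-neighbour of \<open>C\<close> and so
    displaced by \<open>?v\<close>, which is longer than \<open>w\<close>.\<close>
  have unique: "C = E"
    if "C \<in> Ch" "E \<in> Ch" "D \<in> Ch" "\<delta> C D = s" "\<delta> E D = s" "\<delta> C (\<theta> C) = w" "\<delta> E (\<theta> E) = w"
    for C D E
  proof (rule ccontr)
    assume "C \<noteq> E"
    then have "\<delta> C E = s"
      using panel_trans[of D C E s] delta_gen_sym that assms by metis
    then have "\<delta> E (\<theta> E) = ?v"
      using up' that by blast
    then show False
      using that up by simp
  qed
  have "displaced_by Ch \<delta> \<theta> ?v = (\<Union>C\<in>displaced_by Ch \<delta> \<theta> w. {D \<in> Ch. \<delta> C D = s})"
    using up' down unfolding displaced_by_def by blast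
  also have "card \<dots> = (\<Sum>C\<in>displaced_by Ch \<delta> \<theta> w. card {D \<in> Ch. \<delta> C D = s})"
    using finite_Ch unique by (intro card_UN_disjoint) (auto simp: displaced_by_def)
  also have "\<dots> = (\<Sum>C\<in>displaced_by Ch \<delta> \<theta> w. q s)"
    using card_panel assms(2) by (intro sum.cong) (auto simp: displaced_by_def)
  finally show ?thesis
    by simp
qed

section \<open>The invariant ratio on the twisted class\<close>

definition ratio :: "'w \<Rightarrow> real" where
  "ratio w = real (card (displaced_by Ch \<delta> \<theta> w)) / sqrt (real (qw W S q w))"

lemma ratio_up:
  assumes "w \<in> displacements" "s \<in> S"
    and up: "len (s \<otimes> w) = len w + 1" "len (s \<otimes> w \<otimes> \<sigma> s) = len (s \<otimes> w) + 1"
  shows "ratio (s \<otimes> w \<otimes> \<sigma> s) = ratio w"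
proof -
  have w: "w \<in> carrier W" "s \<otimes> w \<in> carrier W"
    using assms disp_closed gen_closed by auto
  \<comment> \<open>By \<open>q_sigma\<close> both sides contribute the factor \<open>q s\<close>,
    so the root gains exactly one, as the count does.\<close>
  have "qw W S q (s \<otimes> w \<otimes> \<sigma> s) = (q s)\<^sup>2 * qw W S q w"
    using qw_mult_gen[OF sigma_gen[OF assms(2)] w(2) up(2)] qw_gen_mult[OF assms(2) w(1) up(1)]
    by (simp add: q_sigma[OF assms(2)] power2_eq_square)
  then have "sqrt (real (qw W S q (s \<otimes> w \<otimes> \<sigma> s))) = real (q s) * sqrt (real (qw W S q w))"
    by (simp add: real_sqrt_mult)
  moreover have "q s \<noteq> 0"
    using q_ge_2[OF assms(2)] by simp
  ultimately show ?thesis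
    using card_displaced_up[OF assms] by (simp add: ratio_def)
qed

lemma ratio_conj_gen:
  assumes "w \<in> displacements" "s \<in> S"
  shows "ratio (s \<otimes> w \<otimes> \<sigma> s) = ratio w"
  using assms
proof (cases rule: disp_conj_gen_cases)
  case fixed
  then show ?thesis
    by simp
next
  case up
  then show ?thesis
    using ratio_up assms by blast
next
  case down
  let ?t = "\<sigma> s" and ?v = "s \<otimes> w \<otimes> \<sigma> s"
  have t: "?t \<in> S" and w: "w \<in> carrier W"
    using assms sigma_gen disp_closed by blast+
  note cl = w gen_closed[OF assms(2)] gen_closed[OF t]
  have v: "?v \<in> displacements" "s \<otimes> ?v = w \<otimes> ?t"
    using disp_conj_gen[OF assms] cl assms(2) t by (simp_all add: m_assoc gen_cancel_left gen_sq)
  \<comment> \<open>Conjugating \<open>?v\<close> by \<open>s\<close> returns to \<open>w\<close>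
    through \<open>s ?v = w ?t\<close>, so \<open>ratio_up\<close> needs the length of
    \<open>w ?t\<close> as the middle one.\<close>
  have "len (w \<otimes> ?t) = len ?v + 1" "len w = len (w \<otimes> ?t) + 1"
    using down len_mult_gen[OF t w] len_gen_mult[OF assms(2) disp_closed[OF v(1)], unfolded v(2)]
    by linarith+
  then show ?thesis
    using ratio_up[OF v(1) assms(2), unfolded v(2) gen_cancel_right[OF t w]] by metis
qed

lemma disp_conj:
  assumes "w \<in> displacements" "v \<in> carrier W"
  shows "inv v \<otimes> w \<otimes> \<sigma> v \<in> displacements \<and> ratio (inv v \<otimes> w \<otimes> \<sigma> v) = ratio w"
proof -
  have w: "w \<in> carrier W"
    using assms disp_closed by blast
  obtain ws where ws: "ws \<in> lists S" "word_prod W ws = v"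
    using expression_exists assms by blast
  have "inv (word_prod W ws) \<otimes> w \<otimes> \<sigma> (word_prod W ws) \<in> displacements \<and>
      ratio (inv (word_prod W ws) \<otimes> w \<otimes> \<sigma> (word_prod W ws)) = ratio w"
    using ws(1)
  \<comment> \<open>The last letter of \<open>v\<close> becomes the outermost conjugation.\<close>
  proof (induction ws rule: rev_induct)
    case Nil
    then show ?case
      using w assms by (simp add: word_prod_Nil sigma_one)
  next
    case (snoc s us)
    define u where "u = word_prod W us"
    have s: "s \<in> S" and us: "us \<in> lists S"
      using snoc.prems by auto
    note cl = gen_closed[OF s] w word_prod_closed[OF us, folded u_def]
    have "word_prod W (us @ [s]) = u \<otimes> s"
      using word_prod_append[OF us, of "[s]"] s cl by (simp add: word_prod_Cons word_prod_Nil u_def)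
    moreover have "inv (u \<otimes> s) \<otimes> w \<otimes> \<sigma> (u \<otimes> s) = s \<otimes> (inv u \<otimes> w \<otimes> \<sigma> u) \<otimes> \<sigma> s"
      using cl s sigma_closed by (simp add: inv_mult_group gens_inv sigma_mult m_assoc)
    ultimately show ?case
      using snoc.IH[OF us] disp_conj_gen ratio_conj_gen s unfolding u_def by metis
  qed
  then show ?thesis
    using ws by simp
qed

text \<open>Closure under twisted conjugation gives one inclusion; the other holds because two
  members of the class of \<open>u\<close> are twisted conjugates of each other.\<close>

lemma disp_eq_twisted_class:
  assumes "w \<in> displacements"
  shows "displacements = twisted_class W \<sigma> w"
proof
  obtain u where u: "u \<in> carrier W" "displacements \<subseteq> twisted_class W \<sigma> u"
    using uniclass by (auto simp: uniclass_def)
  obtain a where a: "a \<in> carrier W" "w = inv a \<otimes> u \<otimes> \<sigma> a"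
    using subsetD[OF u(2) assms] by (elim twisted_classE)
  show "displacements \<subseteq> twisted_class W \<sigma> w"
  proof
    fix x assume "x \<in> displacements"
    then have "x \<in> twisted_class W \<sigma> u"
      using u(2) by blast
    then obtain b where b: "b \<in> carrier W" "x = inv b \<otimes> u \<otimes> \<sigma> b"
      by (elim twisted_classE)
    \<comment> \<open>\<open>w\<close> and \<open>x\<close> arise from \<open>u\<close> by
      conjugation with \<open>a\<close> and \<open>b\<close>; undoing \<open>a\<close> and then
      applying \<open>b\<close> carries \<open>w\<close> to \<open>x\<close>.\<close>
    define v where "v = inv a \<otimes> b"
    have v: "v \<in> carrier W" "a \<otimes> v = b"
      using a b by (simp_all add: v_def m_assoc[symmetric])
    have "inv v \<otimes> w \<otimes> \<sigma> v = inv (a \<otimes> v) \<otimes> u \<otimes> \<sigma> (a \<otimes> v)"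
      using a u v(1) sigma_closed by (simp add: inv_mult_group sigma_mult m_assoc)
    then have "x = inv v \<otimes> w \<otimes> \<sigma> v"
      using b v by simp
    then show "x \<in> twisted_class W \<sigma> w"
      using v unfolding twisted_class_def by blast
  qed
  show "twisted_class W \<sigma> w \<subseteq> displacements"
    using disp_conj[OF assms] by (auto elim: twisted_classE)
qed

text \<open>Sorting all chambers by displacement gives \<open>ratio w\<close> times the root series;
  sorting them by distance from one chamber gives \<open>W(q)\<close>. Comparing the two determines
  \<open>ratio w\<close>.\<close>

lemma card_displaced:
  assumes "finite (carrier W)" "w \<in> displacements"
  shows "real (card (displaced_by Ch \<delta> \<theta> w)) =
    q_series W S q (carrier W) / sqrt_q_series W S q displacements * sqrt (real (qw W S q w))"
proof -
  have card: "real (card (displaced_by Ch \<delta> \<theta> x)) = ratio w * sqrt (real (qw W S q x))"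
    if "x \<in> displacements" for x
  proof -
    have "ratio x = ratio w"
      using that[unfolded disp_eq_twisted_class[OF assms(2)]] disp_conj[OF assms(2)]
      by (metis twisted_classE)
    then show ?thesis
      using qw_pos[OF disp_closed[OF that]] by (auto simp: ratio_def field_simps)
  qed
  have fin: "finite displacements"
    using assms(1) disp_closed by (meson finite_subset subsetI)
  have "card Ch = (\<Sum>x\<in>displacements. card (displaced_by Ch \<delta> \<theta> x))"
    using sum.group[of Ch displacements "\<lambda>C. \<delta> C (\<theta> C)" "\<lambda>_. 1::nat"] disp_in finite_Ch fin
    by (force simp: image_subset_iff displaced_by_def)
  then have "real (card Ch) = ratio w * sqrt_q_series W S q displacements"
    by (simp add: card sqrt_q_series_def sum_distrib_left)
  moreover have "sqrt_q_series W S q displacements > 0"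
    unfolding sqrt_q_series_def using fin assms(2) qw_pos disp_closed by (intro sum_pos) auto
  ultimately have "ratio w = q_series W S q (carrier W) / sqrt_q_series W S q displacements"
    using card_Ch[OF assms(1)] by (simp add: field_simps)
  then show ?thesis
    using card[OF assms(2)] by simp
qed

end

theorem theorem2p17:
  fixes W :: "('w, 'b) monoid_scheme" (structure)
    and S :: "'w set"
    and Ch :: "'c set"
    and \<delta> :: "'c \<Rightarrow> 'c \<Rightarrow> 'w"
    and q :: "'w \<Rightarrow> nat"
    and \<theta> :: "'c \<Rightarrow> 'c"
    and \<sigma> :: "'w \<Rightarrow> 'w"
  assumes "building W S Ch \<delta>"
    and "finite Ch"
    and "finite (carrier W)"
    and "thick S Ch \<delta>"
    and "has_parameters S Ch \<delta> q"
    and "building_automorphism W S Ch \<delta> \<theta>"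
    and "\<sigma> \<in> auto W"
    and "companion W S Ch \<delta> \<theta> \<sigma>"
    and "group.ord (AutoGroup W) \<sigma> = 1 \<or> group.ord (AutoGroup W) \<sigma> = 2"
    and "uniclass W Ch \<delta> \<theta> \<sigma>"
  shows "(\<exists>w\<in>carrier W. disp Ch \<delta> \<theta> = twisted_class W \<sigma> w) \<and>
    (\<forall>w\<in>disp Ch \<delta> \<theta>. real (card (displaced_by Ch \<delta> \<theta> w)) =
       q_series W S q (carrier W) / sqrt_q_series W S q (disp Ch \<delta> \<theta>) * sqrt (real (qw W S q w)))"
proof -
  interpret building W S Ch \<delta>
    by fact
  interpret uniclass_automorphism W S Ch \<delta> q \<theta> \<sigma>
    by unfold_locales (use assms in \<open>auto simp: building_automorphism_def\<close>)
  \<comment> \<open>Any chamber supplies a displacement to represent the class.\<close>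
  obtain C where "C \<in> Ch"
    using Ch_nonempty by blast
  then show ?thesis
    using disp_in disp_closed disp_eq_twisted_class card_displaced[OF assms(3)] by blast
qed

end
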